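(* Let $(X,\leq_X)$ be a partially ordered set and let $p$ be a partial metric on $X$ such that $(X,p)$ is complete. Let $f:X\to X$ be a non-decreasing map with respect to $\leq_X$. Suppose that: (i) for all $x,y\in X$ with $y\leq_X x$, $$p(fx,fy)\leq p(x,y)-\psi(p(x,y)),$$ where $\psi:[0,+\infty)\to[0,+\infty)$ is a continuous and non-decreasing function such that $\psi(t)>0$ for all $t>0$, $\psi(0)=0$ and $\lim_{t\to+\infty}\psi(t)=+\infty$; (ii) there exists $x_0\in X$ such that $x_0\leq_X fx_0$; and that at least one of the following two conditions holds: (iii) $f$ is continuous in $(X,p)$; or (iii') whenever a sequence $\{x_n\}$ in $X$ that is non-decreasing with respect to $\leq_X$ converges in $(X,p)$ to a point $x\in X$, then $x_n\leq_X x$ for all $n$. Then $f$ has a fixed point $u\in X$. Moreover, $p(u,u)=0$.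
   Context: A partial metric on a nonempty set $X$ is a function $p:X\times X\to[0,+\infty)$ such that for all $x,y,z\in X$: (p1) $x=y$ if and only if $p(x,x)=p(x,y)=p(y,y)$; (p2) $p(x,x)\leq p(x,y)$; (p3) $p(x,y)=p(y,x)$; (p4) $p(x,y)\leq p(x,z)+p(z,y)-p(z,z)$. The pair $(X,p)$ is called a partial metric space. The function $p^s(x,y)=2p(x,y)-p(x,x)-p(y,y)$ is then a metric on $X$. A sequence $\{x_n\}$ converges to $x\in X$ in $(X,p)$ if $p(x,x)=\lim_{n\to+\infty}p(x,x_n)$. It converges properly to $x$ if $p(x,x)=\lim_{n\to+\infty}p(x_n,x_n)=\lim_{n\to+\infty}p(x,x_n)$, equivalently $\lim_{n\to+\infty}p^s(x,x_n)=0$. It is a Cauchy sequence in $(X,p)$ if $\lim_{n,m\to+\infty}p(x_n,x_m)$ exists and is finite. $(X,p)$ is complete if every Cauchy sequence $\{x_n\}$ in $X$ converges to a point $x\in X$ such that $p(x,x)=\lim_{n,m\to+\infty}p(x_n,x_m)$. A map $T:X\to X$ is continuous in $(X,p)$ if for every $x_0\in X$ and every sequence $\{x_n\}$ in $X$: (a) if $x_n$ converges to $x_0$ in $(X,p)$ then $Tx_n$ converges to $Tx_0$ in $(X,p)$; and (b) if $x_n$ converges properly to $x_0$ in $(X,p)$ then $Tx_n$ converges properly to $Tx_0$ in $(X,p)$. A map $f:X\to X$ is non-decreasing with respect to $\leq_X$ if $x\leq_X y$ implies $fx\leq_X fy$. We write $fx$ for $f(x)$. *)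

theory Defs
  imports "HOL-Analysis.Analysis"
begin

text \<open>
  As in \<^locale>\<open>Metric_space\<close>, the space is an explicit carrier set. All conditions on \<open>p\<close>
  are relativised to the carrier; its values elsewhere are irrelevant.
\<close>

locale partial_metric_space =
  fixes X :: "'a set" and p :: "'a \<Rightarrow> 'a \<Rightarrow> real"
  assumes nonempty: "X \<noteq> {}"
    and nonneg: "\<lbrakk>x \<in> X; y \<in> X\<rbrakk> \<Longrightarrow> 0 \<le> p x y"
    and eq_iff: "\<lbrakk>x \<in> X; y \<in> X\<rbrakk> \<Longrightarrow> x = y \<longleftrightarrow> p x x = p x y \<and> p x y = p y y"
    and small_self: "\<lbrakk>x \<in> X; y \<in> X\<rbrakk> \<Longrightarrow> p x x \<le> p x y"
    and commute: "\<lbrakk>x \<in> X; y \<in> X\<rbrakk> \<Longrightarrow> p x y = p y x"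
    and triangle: "\<lbrakk>x \<in> X; y \<in> X; z \<in> X\<rbrakk> \<Longrightarrow> p x y \<le> p x z + p z y - p z z"
begin

definition pconverges :: "(nat \<Rightarrow> 'a) \<Rightarrow> 'a \<Rightarrow> bool" where
  "pconverges \<sigma> x \<longleftrightarrow> range \<sigma> \<subseteq> X \<and> x \<in> X \<and> (\<lambda>n. p x (\<sigma> n)) \<longlonglongrightarrow> p x x"

definition pconverges_properly :: "(nat \<Rightarrow> 'a) \<Rightarrow> 'a \<Rightarrow> bool" where
  "pconverges_properly \<sigma> x \<longleftrightarrow> range \<sigma> \<subseteq> X \<and> x \<in> X \<and>
     (\<lambda>n. p (\<sigma> n) (\<sigma> n)) \<longlonglongrightarrow> p x x \<and> (\<lambda>n. p x (\<sigma> n)) \<longlonglongrightarrow> p x x"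

definition pdouble_limit :: "(nat \<Rightarrow> 'a) \<Rightarrow> real \<Rightarrow> bool" where
  "pdouble_limit \<sigma> l \<longleftrightarrow>
     ((\<lambda>(n, m). p (\<sigma> n) (\<sigma> m)) \<longlongrightarrow> l) (sequentially \<times>\<^sub>F sequentially)"

definition pCauchy :: "(nat \<Rightarrow> 'a) \<Rightarrow> bool" where
  "pCauchy \<sigma> \<longleftrightarrow> range \<sigma> \<subseteq> X \<and> (\<exists>l. pdouble_limit \<sigma> l)"

definition pcomplete :: bool where
  "pcomplete \<longleftrightarrow> (\<forall>\<sigma>. pCauchy \<sigma> \<longrightarrow> (\<exists>x. pconverges \<sigma> x \<and> pdouble_limit \<sigma> (p x x)))"

definition pcontinuous :: "('a \<Rightarrow> 'a) \<Rightarrow> bool" where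
  "pcontinuous T \<longleftrightarrow> (\<forall>x\<^sub>0\<in>X. \<forall>\<sigma>. range \<sigma> \<subseteq> X \<longrightarrow>
     (pconverges \<sigma> x\<^sub>0 \<longrightarrow> pconverges (\<lambda>n. T (\<sigma> n)) (T x\<^sub>0)) \<and>
     (pconverges_properly \<sigma> x\<^sub>0 \<longrightarrow> pconverges_properly (\<lambda>n. T (\<sigma> n)) (T x\<^sub>0)))"

end

end

theory Submission
  imports Defs
begin

text \<open>
  The Picard iterates of \<open>x\<^sub>0\<close> form a chain, so the contraction applies to any two of them. The
  distances \<open>d\<^sub>n\<close> between consecutive iterates satisfy \<open>d\<^sub>n\<^sub>+\<^sub>1 \<le> d\<^sub>n - \<psi> d\<^sub>n\<close>, whence \<open>d\<^sub>n\<close> tends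
  to \<open>0\<close>. Once \<open>d\<^sub>N \<le> min (\<epsilon>/2) (\<psi> (\<epsilon>/2))\<close>, the ball of radius \<open>\<epsilon>\<close> around the \<open>N\<close>-th iterate
  traps the rest of the orbit, so the orbit is Cauchy with double limit \<open>0\<close>. The limit \<open>u\<close> given
  by completeness satisfies \<open>p u u = 0\<close>, and either alternative hypothesis makes the orbit
  converge to \<open>f u\<close> with \<open>p (f u) (x\<^sub>n) \<longlongrightarrow> 0\<close> as well.
\<close>

text \<open>The sequence decreases to some \<open>L \<ge> 0\<close>. Monotonicity of
  \<open>\<psi>\<close> makes every drop at least \<open>\<psi> L\<close>, and passing to the limit
  leaves \<open>\<psi> L \<le> 0\<close>, which forces \<open>L = 0\<close>.\<close>

lemma tendsto_zero_of_psi_descent: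
  fixes d :: "nat \<Rightarrow> real"
  assumes nonneg: "\<And>n. 0 \<le> d n"
    and step: "\<And>n. d (Suc n) \<le> d n - \<psi> (d n)"
    and mono: "mono_on {0..} \<psi>"
    and pos: "\<And>t. t > 0 \<Longrightarrow> \<psi> t > 0"
    and zero: "\<psi> 0 = 0"
  shows "d \<longlonglongrightarrow> 0"
proof -
  have \<psi>_nonneg: "0 \<le> \<psi> t" if "0 \<le> t" for t
    using pos[of t] zero that by (cases "t = 0") auto
  have "decseq d"
  proof (rule decseq_SucI)
    fix n show "d (Suc n) \<le> d n"
      using step[of n] \<psi>_nonneg[OF nonneg[of n]] by linarith
  qed
  then obtain L where L: "d \<longlonglongrightarrow> L" and Lle: "\<And>n. L \<le> d n"
    using decseq_convergent[of d 0] nonneg by blast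
  have "0 \<le> L"
    using L nonneg by (intro LIMSEQ_le_const) auto
  have "d (Suc n) \<le> d n - \<psi> L" for n
    using step[of n] monotone_onD[OF mono, of L "d n"] \<open>0 \<le> L\<close> Lle[of n] nonneg[of n] by auto
  moreover have "(\<lambda>n. d (Suc n)) \<longlonglongrightarrow> L" "(\<lambda>n. d n - \<psi> L) \<longlonglongrightarrow> L - \<psi> L"
    using L by (auto intro: LIMSEQ_Suc tendsto_intros)
  ultimately have "L \<le> L - \<psi> L"
    by (intro LIMSEQ_le[of "\<lambda>n. d (Suc n)"]) auto
  with pos[of L] \<open>0 \<le> L\<close> have "L = 0" by fastforce
  with L show ?thesis by simp
qed

context partial_metric_space
begin

lemma triangle_le: "\<lbrakk>x \<in> X; y \<in> X; z \<in> X\<rbrakk> \<Longrightarrow> p x y \<le> p x z + p z y"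
  using triangle[of x y z] nonneg[of z z] by linarith

text \<open>Both self-distances lie between 0 and \<open>p x y\<close>, so all three values compared
  in \<open>eq_iff\<close> vanish.\<close>

lemma eq_if_dist_zero:
  assumes "x \<in> X" "y \<in> X" "p x y = 0"
  shows "x = y"
  using assms eq_iff[of x y] small_self[of x y] small_self[of y x] commute[of x y]
    nonneg[of x x] nonneg[of y y] by force

lemma pdouble_limit_unique: "\<lbrakk>pdouble_limit \<sigma> k; pdouble_limit \<sigma> l\<rbrakk> \<Longrightarrow> k = l"
  unfolding pdouble_limit_def by (rule tendsto_unique) (simp_all add: prod_filter_eq_bot)

lemma pdouble_limit_diagonal:
  assumes "pdouble_limit \<sigma> l"
  shows "(\<lambda>n. p (\<sigma> n) (\<sigma> n)) \<longlonglongrightarrow> l"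
proof -
  have "filterlim (\<lambda>n. (n, n)) (sequentially \<times>\<^sub>F sequentially) sequentially"
    by (intro filterlim_Pair filterlim_ident)
  from filterlim_compose[OF assms[unfolded pdouble_limit_def] this] show ?thesis by simp
qed

text \<open>Two points close to a common centre are close to each other, so for each
  \<open>e\<close> it suffices to control distances to one centre \<open>\<sigma> N\<close>.\<close>

lemma pdouble_limit_zeroI:
  assumes X: "range \<sigma> \<subseteq> X"
    and ball: "\<And>e. e > 0 \<Longrightarrow> \<exists>N. \<forall>n\<ge>N. p (\<sigma> n) (\<sigma> N) \<le> e"
  shows "pdouble_limit \<sigma> 0"
  unfolding pdouble_limit_def
proof (rule tendstoI)
  fix e :: real
  assume "e > 0"
  \<comment> \<open>Two radii of \<open>e / 3\<close> add up to less than \<open>e\<close>, which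
    turns the non-strict ball bound into a strict one.\<close>
  then obtain N where N: "p (\<sigma> n) (\<sigma> N) \<le> e / 3" if "n \<ge> N" for n
    using ball[of "e / 3"] by auto
  have "p (\<sigma> n) (\<sigma> m) < e" if "n \<ge> N" "m \<ge> N" for n m
    using triangle_le[of "\<sigma> n" "\<sigma> m" "\<sigma> N"] commute[of "\<sigma> N" "\<sigma> m"] X N[OF that(1)] N[OF that(2)]
      \<open>e > 0\<close> by (auto simp: image_subset_iff)
  then show "\<forall>\<^sub>F x in sequentially \<times>\<^sub>F sequentially. dist (case x of (n, m) \<Rightarrow> p (\<sigma> n) (\<sigma> m)) 0 < e"
    using X nonneg unfolding eventually_prod_filter
    by (intro exI[of _ "\<lambda>n. n \<ge> N"] conjI)
       (auto simp: eventually_ge_at_top dist_real_def image_subset_iff)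
qed

text \<open>Limits for \<open>pconverges\<close> need not be unique. When both distances tend to 0,
  their sum, which dominates \<open>p x y\<close>, does too.\<close>

lemma limit_unique_of_dist_tendsto_zero:
  assumes "range \<sigma> \<subseteq> X" "x \<in> X" "y \<in> X"
    and "(\<lambda>n. p x (\<sigma> n)) \<longlonglongrightarrow> 0" "(\<lambda>n. p y (\<sigma> n)) \<longlonglongrightarrow> 0"
  shows "x = y"
proof -
  have "p x y \<le> p x (\<sigma> n) + p y (\<sigma> n)" for n
    using triangle_le[of x y "\<sigma> n"] commute[of "\<sigma> n" y] assms(1-3) by (auto simp: image_subset_iff)
  moreover have "(\<lambda>n. p x (\<sigma> n) + p y (\<sigma> n)) \<longlonglongrightarrow> 0"
    using tendsto_add[OF assms(4,5)] by simp
  ultimately have "p x y \<le> 0"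
    by (intro LIMSEQ_le_const) auto
  then show ?thesis
    using eq_if_dist_zero nonneg assms(2,3) by force
qed

text \<open>The contraction is asked only for \<open>m \<le> n\<close>, with the later index first:
  along a chain these are the pairs that the order condition reaches.\<close>

lemma pdouble_limit_zero_of_weak_contraction:
  assumes X: "range \<sigma> \<subseteq> X"
    and contr: "\<And>m n. m \<le> n \<Longrightarrow>
      p (\<sigma> (Suc n)) (\<sigma> (Suc m)) \<le> p (\<sigma> n) (\<sigma> m) - \<psi> (p (\<sigma> n) (\<sigma> m))"
    and mono: "mono_on {0..} \<psi>"
    and pos: "\<And>t. t > 0 \<Longrightarrow> \<psi> t > 0"
    and zero: "\<psi> 0 = 0"
  shows "pdouble_limit \<sigma> 0"
proof (rule pdouble_limit_zeroI[OF X])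
  fix e :: real
  assume "e > 0"
  have in_X: "\<sigma> n \<in> X" for n
    using X by auto
  have \<psi>_nonneg: "0 \<le> \<psi> t" if "0 \<le> t" for t
    using pos[of t] zero that by (cases "t = 0") auto
  define d where "d n = p (\<sigma> (Suc n)) (\<sigma> n)" for n
  have "d \<longlonglongrightarrow> 0"
  proof (rule tendsto_zero_of_psi_descent[OF _ _ mono pos zero])
    show "0 \<le> d n" "d (Suc n) \<le> d n - \<psi> (d n)" for n
      using nonneg in_X contr[of n "Suc n"] by (auto simp: d_def)
  qed
  \<comment> \<open>The two bounds serve the two cases of the induction step: \<open>e / 2\<close>
    fills the gap when \<open>t \<le> e / 2\<close>, and \<open>\<psi> (e / 2)\<close> is absorbed
    by the contraction when \<open>t\<close> is larger.\<close>
  moreover have "min (e / 2) (\<psi> (e / 2)) > 0"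
    using \<open>e > 0\<close> pos by simp
  ultimately obtain N where N: "d N < min (e / 2) (\<psi> (e / 2))"
    using order_tendstoD(2) eventually_sequentially by (metis order_refl)
  have "p (\<sigma> n) (\<sigma> N) \<le> e" if "n \<ge> N" for n
    using that
  proof (induction n rule: dec_induct)
    \<comment> \<open>The self-distance of the centre may be positive, but it is at most
      \<open>d N\<close>.\<close>
    case base
    then show ?case
      using small_self[of "\<sigma> N" "\<sigma> (Suc N)"] commute[of "\<sigma> N" "\<sigma> (Suc N)"] in_X N \<open>e > 0\<close>
      by (auto simp: d_def)
  next
    case (step n)
    define t where "t = p (\<sigma> n) (\<sigma> N)"
    have "0 \<le> t"
      using nonneg in_X by (simp add: t_def)
    \<comment> \<open>Passing through \<open>\<sigma> (Suc N)\<close> shifts both indices at once,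
      so that the contraction applies, at the cost of \<open>d N\<close>.\<close>
    have "p (\<sigma> (Suc n)) (\<sigma> N) \<le> t - \<psi> t + d N"
      using triangle_le[of "\<sigma> (Suc n)" "\<sigma> N" "\<sigma> (Suc N)"] in_X contr[of N n] step
      by (simp add: d_def t_def)
    also have "\<dots> \<le> e"
    proof (cases "t \<le> e / 2")
      case True
      then show ?thesis
        using N \<psi>_nonneg[OF \<open>0 \<le> t\<close>] by auto
    next
      case False
      then have "\<psi> (e / 2) \<le> \<psi> t"
        using monotone_onD[OF mono, of "e / 2" t] \<open>e > 0\<close> by auto
      then show ?thesis
        using N step by (auto simp: t_def)
    qed
    finally show ?case .
  qed
  then show "\<exists>N. \<forall>n\<ge>N. p (\<sigma> n) (\<sigma> N) \<le> e" by blast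
qed

end

theorem theorem2p1:
  fixes X :: "'a set"
    and r :: "('a \<times> 'a) set"
    and p :: "'a \<Rightarrow> 'a \<Rightarrow> real"
    and f :: "'a \<Rightarrow> 'a"
    and \<psi> :: "real \<Rightarrow> real"
  assumes "partial_order_on X r"
    and "partial_metric_space X p"
    and "partial_metric_space.pcomplete X p"
    and "f \<in> X \<rightarrow> X"
    and "monotone_on X (\<lambda>x y. (x, y) \<in> r) (\<lambda>x y. (x, y) \<in> r) f"
    and "\<psi> \<in> {0..} \<rightarrow> {0..}"
    and "continuous_on {0..} \<psi>"
    and "mono_on {0..} \<psi>"
    and "\<And>t. t > 0 \<Longrightarrow> \<psi> t > 0"
    and "\<psi> 0 = 0"
    and "filterlim \<psi> at_top at_top"
    and "\<And>x y. \<lbrakk>x \<in> X; y \<in> X; (y, x) \<in> r\<rbrakk> \<Longrightarrow> p (f x) (f y) \<le> p x y - \<psi> (p x y)"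
    and "\<exists>x\<^sub>0\<in>X. (x\<^sub>0, f x\<^sub>0) \<in> r"
    and "partial_metric_space.pcontinuous X p f \<or>
         (\<forall>\<sigma> x. range \<sigma> \<subseteq> X \<longrightarrow> x \<in> X \<longrightarrow>
            monotone (\<le>) (\<lambda>x y. (x, y) \<in> r) \<sigma> \<longrightarrow>
            partial_metric_space.pconverges X p \<sigma> x \<longrightarrow> (\<forall>n. (\<sigma> n, x) \<in> r))"
  shows "\<exists>u\<in>X. f u = u \<and> p u u = 0"
proof -
  interpret partial_metric_space X p by (fact assms(2))
  obtain x\<^sub>0 where x\<^sub>0: "x\<^sub>0 \<in> X" "(x\<^sub>0, f x\<^sub>0) \<in> r"
    using assms(13) by blast
  define \<sigma> where "\<sigma> n = (f ^^ n) x\<^sub>0" for n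
  have \<sigma>_Suc: "\<sigma> (Suc n) = f (\<sigma> n)" for n
    by (simp add: \<sigma>_def)
  have in_X: "\<sigma> n \<in> X" for n
    using x\<^sub>0 assms(4) by (induction n) (auto simp: \<sigma>_def)
  have X: "range \<sigma> \<subseteq> X"
    using in_X by blast
  have refl: "(x, x) \<in> r" if "x \<in> X" for x
    using assms(1) that by (auto simp: partial_order_on_def preorder_on_def refl_on_def)
  have "trans r"
    using assms(1) by (auto simp: partial_order_on_def preorder_on_def)
  have le_Suc: "(\<sigma> n, \<sigma> (Suc n)) \<in> r" for n
  proof (induction n)
    case 0
    then show ?case using x\<^sub>0 by (simp add: \<sigma>_def)
  next
    case (Suc n)
    then show ?case
      using monotone_onD[OF assms(5) in_X in_X Suc] by (simp add: \<sigma>_Suc)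
  qed
  have chain: "(\<sigma> m, \<sigma> n) \<in> r" if "m \<le> n" for m n
    using that
  proof (induction n rule: dec_induct)
    case base
    show ?case by (rule refl[OF in_X])
  next
    case (step n)
    then show ?case using le_Suc \<open>trans r\<close> by (meson transD)
  qed
  have lim0: "pdouble_limit \<sigma> 0"
    by (rule pdouble_limit_zero_of_weak_contraction[OF X _ assms(8,9,10)])
       (use assms(12) chain in_X \<sigma>_Suc in auto)
  then obtain u where u: "pconverges \<sigma> u" and "pdouble_limit \<sigma> (p u u)"
    using assms(3) X unfolding pcomplete_def pCauchy_def by blast
  then have puu: "p u u = 0"
    using lim0 pdouble_limit_unique by blast
  have "u \<in> X" and u_lim: "(\<lambda>n. p u (\<sigma> n)) \<longlonglongrightarrow> 0"
    using u puu by (auto simp: pconverges_def)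
  have "f u \<in> X"
    using \<open>u \<in> X\<close> assms(4) by blast
  have self_lim: "(\<lambda>n. p (\<sigma> n) (\<sigma> n)) \<longlonglongrightarrow> 0"
    by (rule pdouble_limit_diagonal[OF lim0])
  have fu_lim: "(\<lambda>n. p (f u) (\<sigma> (Suc n))) \<longlonglongrightarrow> 0"
    using assms(14)
  proof
    assume "pcontinuous f"
    \<comment> \<open>Convergence to \<open>f u\<close> alone leaves \<open>p (f u) (f u)\<close>
      open. Proper convergence also makes it the limit of the self-distances along the orbit, which
      is 0.\<close>
    moreover have "pconverges_properly \<sigma> u"
      using X \<open>u \<in> X\<close> u_lim self_lim puu by (simp add: pconverges_properly_def)
    ultimately have "pconverges_properly (\<lambda>n. \<sigma> (Suc n)) (f u)"
      using X \<open>u \<in> X\<close> unfolding pcontinuous_def \<sigma>_Suc by blast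
    then have "(\<lambda>n. p (\<sigma> (Suc n)) (\<sigma> (Suc n))) \<longlonglongrightarrow> p (f u) (f u)"
      and lim: "(\<lambda>n. p (f u) (\<sigma> (Suc n))) \<longlonglongrightarrow> p (f u) (f u)"
      by (auto simp: pconverges_properly_def)
    then have "p (f u) (f u) = 0"
      using LIMSEQ_unique LIMSEQ_Suc[OF self_lim] by blast
    with lim show ?thesis by simp
  next
    assume "\<forall>\<sigma> x. range \<sigma> \<subseteq> X \<longrightarrow> x \<in> X \<longrightarrow> monotone (\<le>) (\<lambda>x y. (x, y) \<in> r) \<sigma> \<longrightarrow>
      pconverges \<sigma> x \<longrightarrow> (\<forall>n. (\<sigma> n, x) \<in> r)"
    then have "(\<sigma> n, u) \<in> r" for n
      using X \<open>u \<in> X\<close> u chain by (simp add: monotone_on_def)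
    \<comment> \<open>Since the orbit lies below \<open>u\<close>, the contraction compares
      \<open>u\<close> with each iterate and squeezes the distances to \<open>f u\<close> under
      those to \<open>u\<close>.\<close>
    then have "p (f u) (\<sigma> (Suc n)) \<le> p u (\<sigma> n) - \<psi> (p u (\<sigma> n))" for n
      using assms(12) \<open>u \<in> X\<close> in_X \<sigma>_Suc by simp
    moreover have "0 \<le> \<psi> (p u (\<sigma> n))" for n
      using assms(6) nonneg[OF \<open>u \<in> X\<close> in_X] by auto
    ultimately have "p (f u) (\<sigma> (Suc n)) \<le> p u (\<sigma> n)" for n
      by (smt (verit))
    then show ?thesis
      using nonneg[OF \<open>f u \<in> X\<close> in_X]
      by (intro tendsto_sandwich[OF _ _ tendsto_const u_lim]) auto
  qed
  have "f u = u"
    by (rule limit_unique_of_dist_tendsto_zero[OF _ \<open>f u \<in> X\<close> \<open>u \<in> X\<close> fu_lim LIMSEQ_Suc[OF u_lim]])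
       (use in_X in auto)
  with \<open>u \<in> X\<close> puu show ?thesis by blast
qed

end
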